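(* Let $\mathbb{F}$ be an arbitrary infinite field. The algebras $\mathfrak{d}_2$ and $\mathfrak{e}_2(\alpha)$, for $\alpha\in\mathbb{F}$, give a complete list, up to isomorphism, of the elements of $\mathcal{A}_2(\mathbb{F})\setminus\mathcal{K}_2^a(\mathbb{F})$ which have $\mathfrak{a}_2$ as their only proper degeneration.
   Context: Let $V$ be a fixed $2$-dimensional $\mathbb{F}$-vector space with a fixed ordered basis $(v_1^*,v_2^* )$. $\mathcal{A}_2(\mathbb{F})$ is the set of all algebra structures on $V$, i.e. $\mathbb{F}$-algebras $(V,[\,,])$ with $[\,,]:V\times V\to V$ an arbitrary $\mathbb{F}$-bilinear map. $\mathcal{K}_2^a(\mathbb{F})\subseteq\mathcal{A}_2(\mathbb{F})$ is the set of those satisfying $[x,x]=0_V$ for all $x\in V$. Structure vectors: the structure vector of an algebra $\mathfrak{g}$ relative to an ordered basis $(b_1,b_2)$ is $(\alpha_{ijk})_{1\le i,j,k\le 2}\in\mathbb{F}^{8}$, where $[b_i,b_j]=\sum_{k}\alpha_{ijk}b_k$. A structure vector of $\mathfrak{g}$ is its structure vector relative to some ordered basis. Action: $G=\mathrm{GL}(2,\mathbb{F})$ acts on the right on $\mathbb{F}^{8}$ by change of basis: if $\boldsymbol\lambda$ is the structure vector of an algebra structure relative to $(v_i^* )$ and $g=(g_{ij})\in G$, then $\boldsymbol\lambda g$ is the structure vector of the same algebra relative to the basis $v_j=\sum_i g_{ij}v_i^*$. $O(\boldsymbol\lambda)$ denotes the orbit of $\boldsymbol\lambda$, and $\overline{Y}$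 denotes the closure of $Y\subseteq\mathbb{F}^{8}$ in the Zariski topology, whose closed sets are the common zero sets in $\mathbb{F}^8$ of sets of polynomials over $\mathbb{F}$ in $8$ indeterminates. Degeneration: $\mathfrak{g}_1$ degenerates (respectively, properly degenerates) to $\mathfrak{g}_2$ if there are structure vectors $\boldsymbol\lambda_1$ of $\mathfrak{g}_1$ and $\boldsymbol\lambda_2$ of $\mathfrak{g}_2$ with $\boldsymbol\lambda_2\in\overline{O(\boldsymbol\lambda_1)}$ (respectively, $\boldsymbol\lambda_2\in\overline{O(\boldsymbol\lambda_1)}\setminus O(\boldsymbol\lambda_1)$). "$\mathfrak{g}$ has $\mathfrak{a}_2$ as its only proper degeneration" means that the algebras to which $\mathfrak{g}$ properly degenerates are, up to isomorphism, exactly $\mathfrak{a}_2$. Particular algebras: $\mathfrak{a}_2$ has all products zero. $\mathfrak{d}_2$ has $[v_1^*,v_1^*]=v_2^*$ as its only nonzero product of basis elements. For $\alpha\in\mathbb{F}$, $\mathfrak{e}_2(\alpha)$ has $[v_1^*,v_1^*]=v_1^*$, $[v_1^*,v_2^*]=\alpha v_2^*$, $[v_2^*,v_1^*]=(1-\alpha)v_2^*$, $[v_2^*,v_2^*]=0_V$. *)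

theory Defs
  imports "HOL-Analysis.Analysis" "HOL-Library.Poly_Mapping"
begin

text \<open>
  The space \<open>V\<close> with its fixed ordered basis is \<open>'f ^ 2\<close> with the standard basis.
  The index type \<open>2\<close> has the two elements \<open>1\<close> and \<open>2\<close> (where \<open>2 = 0\<close>).
\<close>

type_synonym 'f alg = "'f ^ 2 \<Rightarrow> 'f ^ 2 \<Rightarrow> 'f ^ 2"

definition stdv :: "2 \<Rightarrow> 'f::field ^ 2" where
  "stdv i = axis i 1"

definition algebras :: "'f::field alg set" where
  "algebras = {m. (\<forall>x. Vector_Spaces.linear (*s) (*s) (\<lambda>y. m x y)) \<and>
                  (\<forall>y. Vector_Spaces.linear (*s) (*s) (\<lambda>x. m x y))}"

definition alternating_algebras :: "'f::field alg set" where
  "alternating_algebras = {m \<in> algebras. \<forall>x. m x x = 0}"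

definition alg_iso :: "'f::field alg \<Rightarrow> 'f alg \<Rightarrow> bool" where
  "alg_iso m n \<longleftrightarrow> (\<exists>\<phi>. Vector_Spaces.linear (*s) (*s) \<phi> \<and> bij \<phi> \<and>
                        (\<forall>x y. \<phi> (m x y) = n (\<phi> x) (\<phi> y)))"

text \<open>The bilinear map with prescribed products of standard basis vectors.\<close>

definition alg_of_table :: "(2 \<Rightarrow> 2 \<Rightarrow> 'f ^ 2) \<Rightarrow> 'f::field alg" where
  "alg_of_table P x y = (\<Sum>i\<in>UNIV. \<Sum>j\<in>UNIV. (x $ i * y $ j) *s P i j)"

definition alg_a2 :: "'f::field alg" where
  "alg_a2 = (\<lambda>x y. 0)"

definition alg_d2 :: "'f::field alg" where
  "alg_d2 = alg_of_table (\<lambda>i j. if i = 1 \<and> j = 1 then stdv 2 else 0)"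

definition alg_e2 :: "'f::field \<Rightarrow> 'f alg" where
  "alg_e2 \<alpha> = alg_of_table (\<lambda>i j.
     if i = 1 \<and> j = 1 then stdv 1
     else if i = 1 \<and> j = 2 then \<alpha> *s stdv 2
     else if i = 2 \<and> j = 1 then (1 - \<alpha>) *s stdv 2
     else 0)"

definition ordered_basis :: "(2 \<Rightarrow> 'f::field ^ 2) \<Rightarrow> bool" where
  "ordered_basis b \<longleftrightarrow> inj b \<and> vec.independent (range b) \<and> vec.span (range b) = UNIV"

definition structure_vector :: "'f::field alg \<Rightarrow> (2 \<Rightarrow> 'f ^ 2) \<Rightarrow> 'f ^ (2 \<times> 2 \<times> 2)" where
  "structure_vector m b =
     vec_lambda (\<lambda>(i, j, k). vec.representation (range b) (m (b i) (b j)) (b k))"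

definition structure_vectors :: "'f::field alg \<Rightarrow> ('f ^ (2 \<times> 2 \<times> 2)) set" where
  "structure_vectors m = {structure_vector m b | b. ordered_basis b}"

text \<open>The algebra whose structure vector relative to the standard basis is \<open>l\<close>.\<close>

definition alg_of_vector :: "'f::field ^ (2 \<times> 2 \<times> 2) \<Rightarrow> 'f alg" where
  "alg_of_vector l = alg_of_table (\<lambda>i j. \<Sum>k\<in>UNIV. l $ (i, j, k) *s stdv k)"

definition act :: "'f::field ^ (2 \<times> 2 \<times> 2) \<Rightarrow> 'f ^ 2 ^ 2 \<Rightarrow> 'f ^ (2 \<times> 2 \<times> 2)" where
  "act l g = structure_vector (alg_of_vector l) (\<lambda>j. \<Sum>i\<in>UNIV. g $ i $ j *s stdv i)"

definition orbit :: "'f::field ^ (2 \<times> 2 \<times> 2) \<Rightarrow> ('f ^ (2 \<times> 2 \<times> 2)) set" where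
  "orbit l = {act l g | g. invertible g}"

text \<open>
  Polynomials in indeterminates indexed by \<open>'n\<close> are finitely supported maps from
  monomials (exponent vectors) to coefficients.
\<close>

type_synonym ('n, 'f) mvpoly = "('n \<Rightarrow>\<^sub>0 nat) \<Rightarrow>\<^sub>0 'f"

definition mveval :: "('n::finite, 'f::field) mvpoly \<Rightarrow> 'f ^ 'n \<Rightarrow> 'f" where
  "mveval p x = (\<Sum>e\<in>Poly_Mapping.keys p.
     Poly_Mapping.lookup p e * (\<Prod>i\<in>UNIV. x $ i ^ Poly_Mapping.lookup e i))"

definition zariski_closed :: "('f::field ^ 'n::finite) set \<Rightarrow> bool" where
  "zariski_closed C \<longleftrightarrow> (\<exists>P :: ('n, 'f) mvpoly set. C = {x. \<forall>p\<in>P. mveval p x = 0})"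

definition zariski_closure :: "('f::field ^ 'n::finite) set \<Rightarrow> ('f ^ 'n) set" where
  "zariski_closure Y = zariski_closed hull Y"

definition properly_degenerates :: "'f::field alg \<Rightarrow> 'f alg \<Rightarrow> bool" where
  "properly_degenerates m n \<longleftrightarrow> (\<exists>l1 \<in> structure_vectors m. \<exists>l2 \<in> structure_vectors n.
     l2 \<in> zariski_closure (orbit l1) - orbit l1)"

definition only_proper_degeneration_a2 :: "'f::field alg \<Rightarrow> bool" where
  "only_proper_degeneration_a2 m \<longleftrightarrow>
     (\<forall>n \<in> algebras. properly_degenerates m n \<longleftrightarrow> alg_iso n alg_a2)"

lemma structure_vector_eq:
  assumes "ordered_basis b"
  shows "m (b i) (b j) = (\<Sum>k\<in>UNIV. structure_vector m b $ (i, j, k) *s b k)"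
proof -
  have "m (b i) (b j) =
      (\<Sum>v\<in>range b. vec.representation (range b) (m (b i) (b j)) v *s v)"
    using assms by (intro vec.sum_representation_eq[symmetric]) (auto simp: ordered_basis_def)
  also have "\<dots> = (\<Sum>k\<in>UNIV. vec.representation (range b) (m (b i) (b j)) (b k) *s b k)"
    using assms by (subst sum.reindex) (auto simp: ordered_basis_def)
  finally show ?thesis by (simp add: structure_vector_def)
qed

lemma alg_of_table_in_algebras: "alg_of_table P \<in> algebras"
  unfolding algebras_def
  by (auto simp: alg_of_table_def UNIV_2 algebra_simps vec_eq_iff intro!: Vector_Spaces.linear_iff[THEN iffD2]
      vec.vector_space_axioms)

lemma alg_of_table_stdv: "alg_of_table P (stdv i) (stdv j) = P i j"
  using exhaust_2[of i] exhaust_2[of j]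
  by (auto simp: alg_of_table_def stdv_def axis_def UNIV_2 vec_eq_iff)

lemma ordered_basis_stdv: "ordered_basis (stdv :: 2 \<Rightarrow> 'f::field ^ 2)"
proof -
  have r: "range (stdv :: 2 \<Rightarrow> 'f ^ 2) = cart_basis"
    by (auto simp: stdv_def cart_basis_def)
  show ?thesis
    unfolding ordered_basis_def r
    by (auto simp: inj_def stdv_def axis_eq_axis independent_cart_basis span_cart_basis)
qed

lemma structure_vector_alg_of_vector: "structure_vector (alg_of_vector l) stdv = l"
proof -
  have "structure_vector (alg_of_vector l) stdv $ (i, j, k) = l $ (i, j, k)" for i j k
  proof -
    have "(\<Sum>k\<in>UNIV. l $ (i, j, k) *s stdv k) =
          (\<Sum>k\<in>UNIV. structure_vector (alg_of_vector l) stdv $ (i, j, k) *s stdv k)"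
      using structure_vector_eq[OF ordered_basis_stdv, of "alg_of_vector l" i j]
      by (simp add: alg_of_vector_def alg_of_table_stdv)
    then show ?thesis
      using exhaust_2[of k] by (auto simp: UNIV_2 vec_eq_iff stdv_def axis_def forall_2)
  qed
  then show ?thesis by (simp add: vec_eq_iff)
qed

end

theory Submission
  imports Defs "HOL-Computational_Algebra.Polynomial"
begin

text \<open>
  Since orbits are isomorphism classes of structure vectors, everything reduces to closures of
  isomorphism classes. The class of \<open>d\<^sub>2\<close> together with zero consists of the algebras all of whose
  triple products vanish, and the class of \<open>e\<^sub>2(\<alpha>)\<close> together with zero is a linear space; both sets
  are Zariski closed. Conversely, let \<open>m\<close> be non-alternating. If some \<open>x\<close> and \<open>[x, x]\<close> are
  independent, the bases \<open>(t x, t\<^sup>2 [x, x])\<close> degenerate \<open>m\<close> to \<open>d\<^sub>2\<close> as \<open>t\<close> tends to \<open>0\<close>. Otherwise each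
  \<open>[x, x]\<close> is a multiple of \<open>x\<close>, which yields a basis with \<open>[u, u] = u\<close>,
  \<open>[v, v] = 0\<close> and \<open>[u, v] + [v, u] = v\<close>, and the bases \<open>(u, t v)\<close> degenerate \<open>m\<close> to some \<open>e\<^sub>2(\<alpha>)\<close>.
  If \<open>m\<close> has no proper degeneration but zero, it is isomorphic to this limit.
\<close>

section \<open>Linearity, bilinearity and coordinates as plain equations\<close>

lemma linear_vec_iff:
  fixes f :: "'f::field ^ 'n \<Rightarrow> 'f ^ 'm"
  shows "Vector_Spaces.linear (*s) (*s) f \<longleftrightarrow>
    (\<forall>x y. f (x + y) = f x + f y) \<and> (\<forall>c x. f (c *s x) = c *s f x)"
  by (auto simp: Vector_Spaces.linear_iff vec.vector_space_axioms)

lemma algebras_iff: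
  "m \<in> algebras \<longleftrightarrow>
    (\<forall>x y z. m (x + y) z = m x z + m y z) \<and> (\<forall>x y z. m x (y + z) = m x y + m x z) \<and>
    (\<forall>c x y. m (c *s x) y = c *s m x y) \<and> (\<forall>c x y. m x (c *s y) = c *s m x y)"
  unfolding algebras_def linear_vec_iff by blast

lemma vec2_eq: "x = x $ 1 *s stdv 1 + x $ 2 *s stdv 2"
  by (auto simp: vec_eq_iff forall_2 stdv_def axis_def)

lemma stdv_nth [simp]:
  "stdv 1 $ 1 = 1" "stdv 1 $ 2 = 0" "stdv 2 $ 1 = 0" "stdv 2 $ 2 = 1"
  by (auto simp: stdv_def axis_def)

lemma algebras_zero:
  assumes "m \<in> algebras"
  shows "m 0 y = 0" "m x 0 = 0"
proof -
  have "m (0 *s 0) y = 0 *s m 0 y" "m x (0 *s 0) = 0 *s m x 0"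
    using assms unfolding algebras_iff by blast+
  then show "m 0 y = 0" "m x 0 = 0" by simp_all
qed

section \<open>Bases and isomorphisms\<close>

text \<open>This is the linear map with the vectors \<open>b i\<close> as columns. It lets bases and
  linear bijections be exchanged freely.\<close>

definition lincomb :: "(2 \<Rightarrow> 'f::field ^ 2) \<Rightarrow> 'f ^ 2 \<Rightarrow> 'f ^ 2" where
  "lincomb b x = (\<Sum>i\<in>UNIV. x $ i *s b i)"

lemma lincomb_2: "lincomb b x = x $ 1 *s b 1 + x $ 2 *s b 2"
  by (simp add: lincomb_def UNIV_2)

lemma linear_lincomb: "Vector_Spaces.linear (*s) (*s) (lincomb b)"
  by (auto simp: linear_vec_iff lincomb_2 algebra_simps vector_add_ldistrib vector_smult_assoc)

lemma lincomb_stdv [simp]: "lincomb b (stdv i) = b i"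
  using exhaust_2[of i] by (auto simp: lincomb_2)

lemma linear_eq_lincomb:
  assumes "Vector_Spaces.linear (*s) (*s) \<phi>"
  shows "\<phi> = lincomb (\<lambda>i. \<phi> (stdv i))"
proof
  fix x
  show "\<phi> x = lincomb (\<lambda>i. \<phi> (stdv i)) x"
    using assms unfolding linear_vec_iff lincomb_2 by (subst vec2_eq[of x]) metis
qed

text \<open>A spanning family makes \<open>lincomb b\<close> surjective, hence injective by equality
  of dimensions. Conversely \<open>b\<close> is the image of the standard basis under a linear
  bijection.\<close>

lemma ordered_basis_iff_bij: "ordered_basis b \<longleftrightarrow> bij (lincomb b)"
proof
  assume b: "ordered_basis b"
  interpret l: Vector_Spaces.linear "(*s)" "(*s)" "lincomb b" by (rule linear_lincomb)
  have inj: "inj b" and ind: "vec.independent (range b)" and sp: "vec.span (range b) = UNIV"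
    using b by (auto simp: ordered_basis_def)
  have "range b \<subseteq> range (lincomb b)"
    by (metis image_subsetI lincomb_stdv rangeI)
  then have "vec.span (range b) \<subseteq> range (lincomb b)"
    by (intro vec.span_minimal l.subspace_image vec.subspace_UNIV)
  then have "surj (lincomb b)" using sp by blast
  then show "bij (lincomb b)"
    using vec.linear_surj_imp_inj[OF linear_lincomb] by (auto simp: bij_def)
next
  assume bij: "bij (lincomb b)"
  have img: "range b = lincomb b ` range stdv" by (simp add: image_image)
  have std: "inj (stdv :: 2 \<Rightarrow> 'a ^ 2)" "vec.independent (range (stdv :: 2 \<Rightarrow> 'a ^ 2))"
    "vec.span (range (stdv :: 2 \<Rightarrow> 'a ^ 2)) = UNIV"
    using ordered_basis_stdv by (auto simp: ordered_basis_def)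
  have "inj b"
    using bij std(1) by (metis (no_types, lifting) bij_is_inj injD injI lincomb_stdv)
  moreover have "vec.independent (range b)"
    unfolding img using std bij
    by (intro vec.linear_independent_injective_image linear_lincomb) (auto simp: bij_def)
  moreover have "vec.span (range b) = UNIV"
    unfolding img vec.linear_span_image[OF linear_lincomb] std using bij by (auto simp: bij_def)
  ultimately show "ordered_basis b" by (simp add: ordered_basis_def)
qed

lemma ordered_basis_pair:
  assumes "x \<noteq> 0" "\<And>c. y \<noteq> c *s x"
  shows "ordered_basis (\<lambda>i. if i = 1 then x else y)"
proof -
  let ?b = "\<lambda>i::2. if i = 1 then x else y"
  interpret l: Vector_Spaces.linear "(*s)" "(*s)" "lincomb ?b" by (rule linear_lincomb)
  have "u = 0" if "lincomb ?b u = 0" for u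
  proof (cases "u $ 2 = 0")
    case True
    then show ?thesis using that assms by (auto simp: lincomb_2 vec_eq_iff forall_2)
  next
    case False
    have "u $ 2 *s y = - (u $ 1 *s x)"
      using that by (simp add: lincomb_2 eq_neg_iff_add_eq_0 add.commute)
    then have "y = (- (u $ 1) / u $ 2) *s x"
      using False by (auto simp: vec_eq_iff field_simps)
    then show ?thesis using assms by blast
  qed
  then have "inj (lincomb ?b)" by (simp add: l.inj_iff_eq_0)
  then show ?thesis
    unfolding ordered_basis_iff_bij bij_def
    using vec.linear_inj_imp_surj[OF linear_lincomb] by blast
qed

lemma ex_not_collinear: "\<exists>y :: 'f::field ^ 2. \<forall>c. y \<noteq> c *s x"
proof (cases "x $ 1 = 0")
  case True
  then show ?thesis by (intro exI[of _ "stdv 1"]) (auto simp: vec_eq_iff forall_2)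
next
  case False
  then show ?thesis by (intro exI[of _ "stdv 2"]) (auto simp: vec_eq_iff forall_2)
qed

lemma alg_iso_refl: "alg_iso m m"
  unfolding alg_iso_def by (rule exI[of _ id]) (simp add: linear_vec_iff)

lemma alg_iso_sym:
  assumes "alg_iso m n"
  shows "alg_iso n m"
proof -
  obtain \<phi> where lin: "Vector_Spaces.linear (*s) (*s) \<phi>" and bij: "bij \<phi>"
    and hom: "\<And>x y. \<phi> (m x y) = n (\<phi> x) (\<phi> y)"
    using assms unfolding alg_iso_def by blast
  define \<psi> where "\<psi> = inv \<phi>"
  have 1: "\<phi> (\<psi> x) = x" "\<psi> (\<phi> x) = x" for x
    using bij by (auto simp: \<psi>_def bij_is_surj surj_f_inv_f bij_is_inj)
  have inj: "\<phi> x = \<phi> y \<Longrightarrow> x = y" for x y using bij by (simp add: bij_def inj_eq)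
  have "Vector_Spaces.linear (*s) (*s) \<psi>"
    unfolding linear_vec_iff
  proof (intro conjI allI)
    show "\<psi> (x + y) = \<psi> x + \<psi> y" for x y
      by (rule inj) (use lin in \<open>simp add: 1 linear_vec_iff\<close>)
    show "\<psi> (c *s x) = c *s \<psi> x" for c x
      by (rule inj) (use lin in \<open>simp add: 1 linear_vec_iff\<close>)
  qed
  moreover have "\<psi> (n x y) = m (\<psi> x) (\<psi> y)" for x y
    by (rule inj) (simp add: 1 hom)
  moreover have "bij \<psi>" using bij by (simp add: \<psi>_def bij_imp_bij_inv)
  ultimately show ?thesis unfolding alg_iso_def by (intro exI[of _ "\<psi>"] conjI allI)
qed

lemma alg_iso_trans:
  assumes "alg_iso m n" "alg_iso n p"
  shows "alg_iso m p"
proof -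
  obtain \<phi> where \<phi>: "Vector_Spaces.linear (*s) (*s) \<phi>" "bij \<phi>" "\<forall>x y. \<phi> (m x y) = n (\<phi> x) (\<phi> y)"
    using assms(1) unfolding alg_iso_def by blast
  obtain \<psi> where \<psi>: "Vector_Spaces.linear (*s) (*s) \<psi>" "bij \<psi>" "\<forall>x y. \<psi> (n x y) = p (\<psi> x) (\<psi> y)"
    using assms(2) unfolding alg_iso_def by blast
  have "Vector_Spaces.linear (*s) (*s) (\<psi> \<circ> \<phi>)"
    using \<phi>(1) \<psi>(1) by (simp add: linear_vec_iff)
  moreover have "bij (\<psi> \<circ> \<phi>)" using \<phi>(2) \<psi>(2) by (rule bij_comp)
  moreover have "\<forall>x y. (\<psi> \<circ> \<phi>) (m x y) = p ((\<psi> \<circ> \<phi>) x) ((\<psi> \<circ> \<phi>) y)"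
    using \<phi>(3) \<psi>(3) by simp
  ultimately show ?thesis unfolding alg_iso_def by (intro exI[of _ "\<psi> \<circ> \<phi>"] conjI)
qed

lemma alg_iso_a2_iff:
  fixes m :: "'f::field alg"
  shows "alg_iso m alg_a2 \<longleftrightarrow> m = alg_a2"
proof
  assume "alg_iso m alg_a2"
  then obtain \<phi> :: "'f ^ 2 \<Rightarrow> 'f ^ 2" where lin: "Vector_Spaces.linear (*s) (*s) \<phi>" and bij: "bij \<phi>"
    and hom: "\<And>x y. \<phi> (m x y) = 0"
    unfolding alg_iso_def alg_a2_def by blast
  interpret Vector_Spaces.linear "(*s)" "(*s)" \<phi> by fact
  have "m x y = 0" for x y
    using hom bij by (auto simp: bij_def inj_iff_eq_0)
  then show "m = alg_a2" by (auto simp: alg_a2_def)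
qed (simp add: alg_iso_refl)

lemma alg_of_vector_in_algebras: "alg_of_vector l \<in> algebras"
  unfolding alg_of_vector_def by (rule alg_of_table_in_algebras)

lemma alg_of_vector_stdv: "alg_of_vector l (stdv i) (stdv j) = (\<chi> k. l $ (i, j, k))"
  by (auto simp: alg_of_vector_def alg_of_table_stdv UNIV_2 vec_eq_iff forall_2)

lemma algebra_expand:
  assumes "m \<in> algebras"
  shows "m (lincomb b x) (lincomb b y) = (\<Sum>i\<in>UNIV. \<Sum>j\<in>UNIV. (x $ i * y $ j) *s m (b i) (b j))"
  using assms unfolding lincomb_2 algebras_iff
  by (simp add: UNIV_2 vector_add_ldistrib vector_smult_assoc algebra_simps)

text \<open>Both products are bilinear, so compatibility needs checking only on the four products of
  basis vectors.\<close>

lemma lincomb_hom: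
  assumes m: "m \<in> algebras" and n: "n \<in> algebras"
    and mult: "\<And>i j. m (b i) (b j) = lincomb b (n (stdv i) (stdv j))"
  shows "lincomb b (n x y) = m (lincomb b x) (lincomb b y)"
proof -
  interpret l: Vector_Spaces.linear "(*s)" "(*s)" "lincomb b" by (rule linear_lincomb)
  have "lincomb stdv z = z" for z :: "'a ^ 2"
    using vec2_eq[of z] by (simp add: lincomb_2)
  then have "n x y = (\<Sum>i\<in>UNIV. \<Sum>j\<in>UNIV. (x $ i * y $ j) *s n (stdv i) (stdv j))"
    using algebra_expand[OF n, of stdv x y] by simp
  then show ?thesis
    by (simp add: algebra_expand[OF m] mult l.sum l.scale)
qed

text \<open>The isomorphism is \<open>lincomb b\<close>. It leads from the model \<open>n\<close>,
  given on the standard basis, to the algebra \<open>m\<close> that contains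
  \<open>b\<close>.\<close>

lemma alg_iso_basisI:
  assumes "m \<in> algebras" "n \<in> algebras" "ordered_basis b"
    and "\<And>i j. m (b i) (b j) = lincomb b (n (stdv i) (stdv j))"
  shows "alg_iso n m"
  unfolding alg_iso_def
  using assms lincomb_hom[of m n b] linear_lincomb[of b] ordered_basis_iff_bij[of b] by blast

lemma algebra_eqI:
  assumes "m \<in> algebras" "n \<in> algebras" "\<And>i j. m (stdv i) (stdv j) = n (stdv i) (stdv j)"
  shows "m = n"
proof (intro ext)
  fix x y
  have "lincomb stdv z = z" for z :: "'a ^ 2"
    using vec2_eq[of z] by (simp add: lincomb_2)
  then show "m x y = n x y"
    using lincomb_hom[OF assms(1,2), of stdv x y] assms(3) by simp
qed

section \<open>Structure vectors and orbits\<close>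

lemma structure_vector_lincomb:
  assumes "ordered_basis b"
  shows "m (b i) (b j) = lincomb b (\<chi> k. structure_vector m b $ (i, j, k))"
  using structure_vector_eq[OF assms, of m i j] by (simp add: lincomb_def)

lemma structure_vector_unique:
  assumes b: "ordered_basis b" and "m (b i) (b j) = lincomb b v"
  shows "structure_vector m b $ (i, j, k) = v $ k"
proof -
  have "(\<chi> k. structure_vector m b $ (i, j, k)) = v"
    using structure_vector_lincomb[OF b, of m i j] assms(2) b[unfolded ordered_basis_iff_bij]
    by (auto dest: injD[OF bij_is_inj])
  then show ?thesis by (auto simp: vec_eq_iff)
qed

lemma structure_vectorI:
  assumes "ordered_basis b" "\<And>i j. m (b i) (b j) = lincomb b (\<chi> k. l $ (i, j, k))"
  shows "structure_vector m b = l"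
proof -
  have "structure_vector m b $ (i, j, k) = l $ (i, j, k)" for i j k
    using structure_vector_unique[OF assms(1), of m i j "\<chi> k. l $ (i, j, k)" k] assms(2) by simp
  then show ?thesis by (auto simp: vec_eq_iff)
qed

text \<open>An isomorphism onto \<open>m\<close> carries the standard basis to a basis of
  \<open>m\<close> with the same structure constants, and every basis of \<open>m\<close> arises in
  this way. Base change can thus be replaced by isomorphism.\<close>

lemma structure_vectors_eq:
  assumes m: "m \<in> algebras"
  shows "structure_vectors m = {l. alg_iso (alg_of_vector l) m}"
proof (intro set_eqI iffI)
  fix l assume "l \<in> structure_vectors m"
  then obtain b where b: "ordered_basis b" "l = structure_vector m b"
    by (auto simp: structure_vectors_def)
  show "l \<in> {l. alg_iso (alg_of_vector l) m}"
    using b structure_vector_eq[OF b(1), of m]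
    by (auto intro!: alg_iso_basisI[OF m alg_of_vector_in_algebras b(1)]
        simp: alg_of_vector_stdv lincomb_def)
next
  fix l assume "l \<in> {l. alg_iso (alg_of_vector l) m}"
  then have "alg_iso (alg_of_vector l) m" by simp
  then obtain \<phi> where lin: "Vector_Spaces.linear (*s) (*s) \<phi>" and bij: "bij \<phi>"
    and hom: "\<And>x y. \<phi> (alg_of_vector l x y) = m (\<phi> x) (\<phi> y)"
    unfolding alg_iso_def by blast
  define b where "b = (\<lambda>i. \<phi> (stdv i))"
  have \<phi>: "\<phi> = lincomb b" unfolding b_def by (rule linear_eq_lincomb[OF lin])
  have "ordered_basis b" using bij by (simp add: ordered_basis_iff_bij \<phi>)
  moreover have "m (b i) (b j) = lincomb b (\<chi> k. l $ (i, j, k))" for i j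
    using hom[of "stdv i" "stdv j"] by (simp add: \<phi> alg_of_vector_stdv)
  ultimately show "l \<in> structure_vectors m"
    unfolding structure_vectors_def using structure_vectorI[of b m l] by blast
qed

text \<open>The columns of \<open>g\<close> form a basis exactly when \<open>g\<close> is
  invertible, since their \<open>lincomb\<close> is multiplication by \<open>g\<close>; every basis
  is the family of columns of some matrix.\<close>

lemma orbit_eq: "orbit l = structure_vectors (alg_of_vector l)"
proof -
  have *: "ordered_basis (\<lambda>j. \<Sum>i\<in>UNIV. g $ i $ j *s stdv i) \<longleftrightarrow> invertible g"
    for g :: "'a ^ 2 ^ 2"
  proof -
    have "lincomb (\<lambda>j. \<Sum>i\<in>UNIV. g $ i $ j *s stdv i) = (*v) g"
      by (auto simp: lincomb_2 UNIV_2 vec_eq_iff forall_2 matrix_vector_mult_def algebra_simps)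
    then show ?thesis
      unfolding ordered_basis_iff_bij
      by (simp add: invertible_eq_bij)
  qed
  have **: "\<exists>g :: 'a ^ 2 ^ 2. b = (\<lambda>j. \<Sum>i\<in>UNIV. g $ i $ j *s stdv i)" for b
    by (rule exI[of _ "\<chi> i j. b j $ i"]) (auto simp: fun_eq_iff UNIV_2 vec_eq_iff forall_2)
  show ?thesis
  proof (intro set_eqI iffI)
    fix x assume "x \<in> orbit l"
    then show "x \<in> structure_vectors (alg_of_vector l)"
      unfolding orbit_def structure_vectors_def act_def using * by auto
  next
    fix x assume "x \<in> structure_vectors (alg_of_vector l)"
    then obtain b where b: "ordered_basis b" "x = structure_vector (alg_of_vector l) b"
      by (auto simp: structure_vectors_def)
    obtain g :: "'a ^ 2 ^ 2" where g: "b = (\<lambda>j. \<Sum>i\<in>UNIV. g $ i $ j *s stdv i)"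
      using ** by blast
    have "invertible g" using b(1) unfolding g * .
    then show "x \<in> orbit l"
      unfolding orbit_def act_def b(2) g by blast
  qed
qed

lemma structure_vectors_cong:
  assumes "m \<in> algebras" "n \<in> algebras" "alg_iso m n"
  shows "structure_vectors m = structure_vectors n"
  unfolding structure_vectors_eq[OF assms(1)] structure_vectors_eq[OF assms(2)]
  using alg_iso_trans[OF _ assms(3)] alg_iso_trans[OF _ alg_iso_sym[OF assms(3)]] by auto

text \<open>All structure vectors of \<open>m\<close> share one orbit, so the choice of
  \<open>l1\<close> does not matter. Whether a structure vector of \<open>n\<close> lies in that
  orbit depends only on whether \<open>m\<close> and \<open>n\<close> are isomorphic.\<close>

lemma properly_degenerates_iff:
  assumes m: "m \<in> algebras" and n: "n \<in> algebras"
  shows "properly_degenerates m n \<longleftrightarrow>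
    \<not> alg_iso m n \<and> (\<exists>l \<in> structure_vectors n. l \<in> zariski_closure (structure_vectors m))"
proof -
  have orb: "orbit l = structure_vectors m" if "l \<in> structure_vectors m" for l
    using that structure_vectors_cong[OF alg_of_vector_in_algebras m]
    by (simp add: orbit_eq structure_vectors_eq[OF m])
  have ne: "\<exists>l. l \<in> structure_vectors m"
    using ordered_basis_stdv unfolding structure_vectors_def by blast
  have iso: "alg_iso m n \<longleftrightarrow> l \<in> structure_vectors m" if "l \<in> structure_vectors n" for l
  proof -
    have l: "alg_iso (alg_of_vector l) n" using that by (simp add: structure_vectors_eq[OF n])
    have "alg_iso m n \<longleftrightarrow> alg_iso (alg_of_vector l) m"
      using alg_iso_trans[OF l alg_iso_sym] alg_iso_trans[OF alg_iso_sym l] by auto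
    then show ?thesis by (simp add: structure_vectors_eq[OF m])
  qed
  show ?thesis
    unfolding properly_degenerates_def using orb ne iso by fastforce
qed

section \<open>Zariski closure\<close>

lemma zariski_closure_minimal:
  "zariski_closed C \<Longrightarrow> Y \<subseteq> C \<Longrightarrow> zariski_closure Y \<subseteq> C"
  by (simp add: zariski_closure_def hull_minimal)

lemma zariski_closureI:
  assumes "\<And>p. \<forall>y\<in>Y. mveval p y = 0 \<Longrightarrow> mveval p x = 0"
  shows "x \<in> zariski_closure Y"
  unfolding zariski_closure_def hull_def using assms by (fastforce simp: zariski_closed_def)

lemma mveval_plus: "mveval (p + q) x = mveval p x + mveval q x"
  unfolding mveval_def
  by (rule setsum_keys_plus_distrib) (simp_all add: algebra_simps)

lemma mveval_single:
  "mveval (Poly_Mapping.single e c) x = c * (\<Prod>i\<in>UNIV. x $ i ^ Poly_Mapping.lookup e i)"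
  by (simp add: mveval_def)

lemma mveval_curve:
  fixes p :: "('n::finite, 'f::field) mvpoly" and q :: "'n \<Rightarrow> 'f poly"
  shows "\<exists>r. \<forall>t. mveval p (\<chi> i. poly (q i) t) = poly r t"
  by (rule exI[of _ "\<Sum>e\<in>Poly_Mapping.keys p.
        smult (Poly_Mapping.lookup p e) (\<Prod>i\<in>UNIV. q i ^ Poly_Mapping.lookup e i)"])
    (simp add: mveval_def poly_sum poly_prod)

text \<open>A polynomial vanishing on \<open>Y\<close> restricts to a univariate polynomial along
  the curve. It vanishes at every nonzero \<open>t\<close>, hence at infinitely many points, so it
  is zero and vanishes at \<open>0\<close> too.\<close>

lemma polynomial_curve_limit:
  fixes q :: "'n::finite \<Rightarrow> 'f::field poly"
  assumes inf: "infinite (UNIV :: 'f set)"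
    and Y: "\<And>t. t \<noteq> 0 \<Longrightarrow> (\<chi> i. poly (q i) t) \<in> Y"
  shows "(\<chi> i. poly (q i) 0) \<in> zariski_closure Y"
proof (rule zariski_closureI)
  fix p :: "('n, 'f) mvpoly"
  assume p: "\<forall>y\<in>Y. mveval p y = 0"
  obtain r where r: "\<And>t. mveval p (\<chi> i. poly (q i) t) = poly r t"
    using mveval_curve by blast
  have "UNIV - {0} \<subseteq> {t. poly r t = 0}"
    using Y p by (auto simp flip: r)
  then have "infinite {t. poly r t = 0}"
    using inf by (meson finite_subset infinite_remove)
  then have "r = 0" using poly_roots_finite by blast
  then show "mveval p (\<chi> i. poly (q i) 0) = 0" by (simp add: r)
qed

text \<open>Letting \<open>t \<rightarrow> 0\<close> in the structure vectors relative to the bases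
  \<open>(t ^ a 1 b\<^sub>1, t ^ a 2 b\<^sub>2)\<close>.\<close>

lemma weighted_limit:
  fixes m :: "'f::field alg" and a :: "2 \<Rightarrow> nat"
  defines "l \<equiv> structure_vector m"
  assumes inf: "infinite (UNIV :: 'f set)"
    and m: "m \<in> algebras" and b: "ordered_basis b"
    and weight: "\<And>i j k. l b $ (i, j, k) = 0 \<or> a k \<le> a i + a j"
  shows "vec_lambda (\<lambda>(i, j, k). if a i + a j = a k then l b $ (i, j, k) else 0)
    \<in> zariski_closure (structure_vectors m)"
proof -
  have mult: "m (b i) (b j) = lincomb b (\<chi> k. l b $ (i, j, k))" for i j
    unfolding l_def by (rule structure_vector_lincomb[OF b])
  \<comment> \<open>Rescaling \<open>b i\<close> by \<open>t ^ a i\<close> multiplies the entry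
    \<open>(i, j, k)\<close> by \<open>t\<close> to the power \<open>a i + a j - a k\<close>. Where
    the subtraction on naturals truncates, \<open>weight\<close> makes the entry zero.\<close>
  define q where "q = (\<lambda>(i, j, k). monom (l b $ (i, j, k)) (a i + a j - a k))"
  have "(\<chi> i. poly (q i) t) \<in> structure_vectors m" if t: "t \<noteq> 0" for t
  proof -
    define c where "c i = t ^ a i *s b i" for i
    have lc: "lincomb c x = lincomb b (\<chi> i. t ^ a i * x $ i)" for x
      by (simp add: lincomb_2 c_def vector_smult_assoc mult.commute)
    have "bij (lincomb b)" using b by (simp add: ordered_basis_iff_bij)
    moreover have "bij (\<lambda>x. (\<chi> i. t ^ a i * x $ i) :: 'f ^ 2)"
      using t by (intro bij_betw_byWitness[where f' = "\<lambda>x. \<chi> i. x $ i / t ^ a i"])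
        (auto simp: vec_eq_iff)
    ultimately have "bij (lincomb c)"
      unfolding lc[abs_def] using bij_comp[unfolded comp_def] by blast
    then have c: "ordered_basis c" by (simp add: ordered_basis_iff_bij)
    have "m (c i) (c j) = lincomb c (\<chi> k. (\<chi> i. poly (q i) t) $ (i, j, k))" for i j
    proof -
      interpret lb: Vector_Spaces.linear "(*s)" "(*s)" "lincomb b" by (rule linear_lincomb)
      have "m (c i) (c j) = t ^ (a i + a j) *s m (b i) (b j)"
        using m by (simp add: algebras_iff c_def vector_smult_assoc power_add)
      also have "\<dots> = lincomb b (t ^ (a i + a j) *s (\<chi> k. l b $ (i, j, k)))"
        by (simp add: mult lb.scale)
      also have "t ^ (a i + a j) *s (\<chi> k. l b $ (i, j, k)) =
          (\<chi> k. t ^ a k * poly (q (i, j, k)) t)"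
      proof (simp add: vec_eq_iff, intro allI)
        fix k
        show "t ^ (a i + a j) * l b $ (i, j, k) = t ^ a k * poly (q (i, j, k)) t"
          using weight[of i j k]
          by (auto simp: q_def poly_monom algebra_simps simp flip: power_add)
      qed
      also have "lincomb b \<dots> = lincomb c (\<chi> k. (\<chi> i. poly (q i) t) $ (i, j, k))"
        by (simp add: lc)
      finally show ?thesis .
    qed
    from structure_vectorI[OF c this] c show ?thesis
      unfolding structure_vectors_def by (intro CollectI exI[of _ c]) simp
  qed
  from polynomial_curve_limit[OF inf this]
  have "(\<chi> i. poly (q i) 0) \<in> zariski_closure (structure_vectors m)" .
  moreover have "poly (q (i, j, k)) 0 = (if a i + a j = a k then l b $ (i, j, k) else 0)" for i j k
    using weight[of i j k] by (auto simp: q_def poly_monom power_0_left)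
  then have "(\<chi> i. poly (q i) 0) = vec_lambda (\<lambda>(i, j, k). if a i + a j = a k then l b $ (i, j, k) else 0)"
    by (auto simp: vec_eq_iff)
  ultimately show ?thesis by simp
qed


text \<open>With constant weight 1 the equation \<open>a i + a j = a k\<close> reads 1 + 1 = 1, so
  no entry survives in the limit.\<close>

lemma zero_in_zariski_closure:
  fixes m :: "'f::field alg"
  assumes "infinite (UNIV :: 'f set)" "m \<in> algebras"
  shows "0 \<in> zariski_closure (structure_vectors m)"
proof -
  have "vec_lambda (\<lambda>(i, j, k). if (1::nat) + 1 = 1 then structure_vector m stdv $ (i, j, k) else 0)
      \<in> zariski_closure (structure_vectors m)"
    by (rule weighted_limit[OF assms ordered_basis_stdv, of "\<lambda>_. 1"]) simp
  moreover have "vec_lambda (\<lambda>(i, j, k). if (1::nat) + 1 = 1 then structure_vector m stdv $ (i, j, k) else 0) = 0"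
    by (auto simp: vec_eq_iff)
  ultimately show ?thesis by simp
qed

section \<open>Polynomial functions, the elements of \<open>range mveval\<close>, as equations of
  closed sets\<close>

lemma polynomial_add:
  "f \<in> range mveval \<Longrightarrow> g \<in> range mveval \<Longrightarrow> (\<lambda>x. f x + g x) \<in> range mveval"
  by (auto simp: image_iff fun_eq_iff mveval_plus[symmetric])

lemma mveval_monomial:
  "mveval (Poly_Mapping.single (Poly_Mapping.single i 1) c) x = c * x $ i"
proof -
  have "(\<Prod>k\<in>UNIV. x $ k ^ Poly_Mapping.lookup (Poly_Mapping.single i 1) k) = (\<Prod>k\<in>{i}. x $ k)"
    by (rule prod.mono_neutral_cong_right) (auto simp: lookup_single)
  then show ?thesis by (simp add: mveval_single)
qed

lemma polynomial_linear: "(\<lambda>x. c * x $ i) \<in> range mveval"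
  by (rule range_eqI[of _ _ "Poly_Mapping.single (Poly_Mapping.single i 1) c"])
    (simp add: mveval_monomial fun_eq_iff del: One_nat_def)

lemma polynomial_quadratic: "(\<lambda>x. x $ i * x $ j) \<in> range mveval"
proof (rule range_eqI[of _ _ "Poly_Mapping.single
      (Poly_Mapping.single i 1 + Poly_Mapping.single j 1) 1"], rule ext)
  fix x
  show "x $ i * x $ j = mveval (Poly_Mapping.single
      (Poly_Mapping.single i 1 + Poly_Mapping.single j 1) 1) x"
    using mveval_monomial[of i 1 x] mveval_monomial[of j 1 x]
    by (simp add: mveval_single lookup_add power_add prod.distrib)
qed

text \<open>This allows equations to be given as functions; the required set of polynomials is the
  preimage of \<open>E\<close> under \<open>mveval\<close>.\<close>

lemma zariski_closedI:
  assumes "E \<subseteq> range mveval" "C = {x. \<forall>f\<in>E. f x = 0}"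
  shows "zariski_closed C"
  unfolding zariski_closed_def
  by (rule exI[of _ "{p. mveval p \<in> E}"]) (use assms in blast)

section \<open>The algebras $d_2$ and $e_2(\alpha)$\<close>

lemma alg_of_vector_0: "alg_of_vector 0 = alg_a2"
  by (simp add: alg_of_vector_def alg_of_table_def alg_a2_def fun_eq_iff)

lemma alg_a2_in_algebras: "alg_a2 \<in> algebras"
  unfolding alg_of_vector_0[symmetric] by (rule alg_of_vector_in_algebras)

lemma alg_d2_in_algebras: "alg_d2 \<in> algebras"
  unfolding alg_d2_def by (rule alg_of_table_in_algebras)

lemma alg_e2_in_algebras: "alg_e2 \<alpha> \<in> algebras"
  unfolding alg_e2_def by (rule alg_of_table_in_algebras)

lemma alg_d2_eq: "alg_d2 x y = (x $ 1 * y $ 1) *s stdv 2"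
  by (auto simp: alg_d2_def alg_of_table_def UNIV_2)

lemma alg_d2_square: "(alg_d2 :: 'f::field alg) (stdv 1) (stdv 1) \<noteq> 0"
  by (simp add: alg_d2_eq vec_eq_iff forall_2)

text \<open>Only the linear form taking \<open>x\<close> to \<open>x $ 1\<close> depends on the
  basis here, which makes the formula easy to transport along isomorphisms.\<close>

lemma alg_e2_eq: "alg_e2 \<alpha> x y = (\<alpha> * x $ 1) *s y + ((1 - \<alpha>) * y $ 1) *s x"
  by (auto simp: alg_e2_def alg_of_table_def UNIV_2 vec_eq_iff forall_2 algebra_simps)

lemma alg_e2_square: "alg_e2 \<alpha> (stdv 1) (stdv 1) \<noteq> 0"
  by (simp add: alg_e2_eq vec_eq_iff forall_2)

lemma not_alternating_iso:
  assumes "alg_iso m n" "n x x \<noteq> 0" "m \<in> algebras"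
  shows "m \<notin> alternating_algebras"
proof
  assume alt: "m \<in> alternating_algebras"
  obtain \<phi> where lin: "Vector_Spaces.linear (*s) (*s) \<phi>" and bij: "bij \<phi>"
    and hom: "\<And>x y. \<phi> (m x y) = n (\<phi> x) (\<phi> y)"
    using assms(1) unfolding alg_iso_def by blast
  interpret Vector_Spaces.linear "(*s)" "(*s)" \<phi> by fact
  obtain y where "x = \<phi> y" using bij by (metis bij_pointE)
  then show False
    using alt hom[of y y] assms(2) by (simp add: alternating_algebras_def zero)
qed

text \<open>The closed set \<open>C\<close> traps the closure of the class of \<open>m\<close>, and
  outside that class it contains at most the zero algebra. The zero algebra itself is reached by
  \<open>zero_in_zariski_closure\<close>.\<close>

lemma only_proper_degeneration_a2I:
  fixes m :: "'f::field alg"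
  assumes inf: "infinite (UNIV :: 'f set)"
    and m: "m \<in> algebras" "m \<noteq> alg_a2" and C: "zariski_closed C"
    and sub: "structure_vectors m \<subseteq> C"
    and C_imp: "\<And>l. l \<in> C \<Longrightarrow> alg_of_vector l \<noteq> alg_a2 \<Longrightarrow> alg_iso (alg_of_vector l) m"
  shows "only_proper_degeneration_a2 m"
  unfolding only_proper_degeneration_a2_def
proof (intro ballI iffI)
  fix n :: "'f alg" assume n: "n \<in> algebras" and "properly_degenerates m n"
  then obtain l where l: "\<not> alg_iso m n" "alg_iso (alg_of_vector l) n"
      "l \<in> zariski_closure (structure_vectors m)"
    using properly_degenerates_iff[OF m(1) n] structure_vectors_eq[OF n] by blast
  then have "l \<in> C" using zariski_closure_minimal[OF C sub] by blast
  moreover have "\<not> alg_iso (alg_of_vector l) m"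
    using l alg_iso_trans[OF alg_iso_sym l(2)] by auto
  ultimately have "alg_of_vector l = alg_a2"
    using C_imp by blast
  then show "alg_iso n alg_a2" using alg_iso_sym[OF l(2)] by simp
next
  fix n :: "'f alg" assume n: "n \<in> algebras" and "alg_iso n alg_a2"
  then have "n = alg_a2" by (simp add: alg_iso_a2_iff)
  moreover have "0 \<in> structure_vectors (alg_a2 :: 'f alg)"
    by (simp add: structure_vectors_eq alg_a2_in_algebras alg_of_vector_0 alg_iso_refl)
  ultimately show "properly_degenerates m n"
    using zero_in_zariski_closure[OF inf m(1)] m
    by (auto simp: properly_degenerates_iff alg_a2_in_algebras alg_iso_a2_iff)
qed

subsection \<open>The orbit closure of $d_2$\<close>

text \<open>The condition is invariant under isomorphism and quadratic in the structure
  constants.\<close>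

definition null_triple_products :: "'f::field alg \<Rightarrow> bool" where
  "null_triple_products m \<longleftrightarrow> (\<forall>x y z. m (m x y) z = 0 \<and> m x (m y z) = 0)"

lemma null_triple_products_iso:
  assumes "alg_iso m n" "null_triple_products n"
  shows "null_triple_products m"
proof -
  obtain \<phi> where lin: "Vector_Spaces.linear (*s) (*s) \<phi>" and bij: "bij \<phi>"
    and hom: "\<And>x y. \<phi> (m x y) = n (\<phi> x) (\<phi> y)"
    using assms(1) unfolding alg_iso_def by blast
  interpret Vector_Spaces.linear "(*s)" "(*s)" \<phi> by fact
  have inj: "\<phi> u = 0 \<longleftrightarrow> u = 0" for u
    using bij by (metis bij_is_inj inj_eq zero)
  have "\<phi> (m (m x y) z) = 0" "\<phi> (m x (m y z)) = 0" for x y z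
    using assms(2) by (simp_all add: null_triple_products_def hom)
  then show ?thesis by (simp add: null_triple_products_def inj)
qed

lemma null_triple_products_d2: "null_triple_products alg_d2"
  by (auto simp: null_triple_products_def alg_d2_eq)

text \<open>Once some square \<open>m x x\<close> is nonzero, \<open>x\<close> and
  \<open>m x x\<close> form a basis with the multiplication table of \<open>alg_d2\<close>.\<close>

lemma null_triple_products_imp_iso_d2:
  assumes m: "m \<in> algebras" and null: "null_triple_products m" and "m \<noteq> alg_a2"
  shows "alg_iso m alg_d2"
proof -
  have null': "m (m x y) z = 0" "m x (m y z) = 0" for x y z
    using null by (auto simp: null_triple_products_def)
  have "\<exists>x. m x x \<noteq> 0"
  proof (rule ccontr)
    assume "\<nexists>x. m x x \<noteq> 0"
    then have alt: "m x x = 0" for x by simp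
    define w where "w = m (stdv 1) (stdv 2)"
    have "m (stdv 1 + stdv 2) (stdv 1 + stdv 2) =
        m (stdv 1) (stdv 1) + w + m (stdv 2) (stdv 1) + m (stdv 2) (stdv 2)"
      using m by (simp add: algebras_iff w_def)
    then have w': "m (stdv 2) (stdv 1) = - w"
      by (simp add: alt eq_neg_iff_add_eq_0 add.commute)
    \<comment> \<open>Both sides are triple products because \<open>w\<close> is itself a product,
      so they vanish and force \<open>w = 0\<close>.\<close>
    have "m w (stdv 2) = w $ 1 *s w" "m (stdv 1) w = w $ 2 *s w"
      using m alt by (subst vec2_eq[of w], simp add: algebras_iff w_def[symmetric])+
    then have "w = 0"
      by (auto simp: w_def null' vec_eq_iff forall_2)
    then have "m (stdv i) (stdv j) = 0" for i j
      using exhaust_2[of i] exhaust_2[of j] alt w' w_def by auto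
    then have "m = alg_a2"
      by (intro algebra_eqI m alg_a2_in_algebras) (simp add: alg_a2_def)
    with assms show False by simp
  qed
  then obtain x where x: "m x x \<noteq> 0" by blast
  define b where "b = (\<lambda>i::2. if i = 1 then x else m x x)"
  \<comment> \<open>Multiplying a relation \<open>m x x = c *s x\<close> by \<open>x\<close> gives a
    triple product on the left, so \<open>c *s m x x = 0\<close>.\<close>
  have "m x x \<noteq> c *s x" for c
  proof
    assume c: "m x x = c *s x"
    then have "m (m x x) x = c *s m x x" using m by (simp add: algebras_iff)
    then have "c *s m x x = 0" by (simp only: null')
    with x c show False by auto
  qed
  moreover have "x \<noteq> 0" using x m algebras_zero by auto
  ultimately have "ordered_basis b" unfolding b_def by (intro ordered_basis_pair)
  moreover have "m (b i) (b j) = lincomb b (alg_d2 (stdv i) (stdv j))" for i j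
    using exhaust_2[of i] exhaust_2[of j]
    by (auto simp: b_def null' alg_d2_eq lincomb_2)
  ultimately have "alg_iso alg_d2 m"
    by (intro alg_iso_basisI m alg_d2_in_algebras)
  then show ?thesis by (rule alg_iso_sym)
qed

lemma null_triple_products_closed:
  "zariski_closed {l :: 'f::field ^ (2 \<times> 2 \<times> 2). null_triple_products (alg_of_vector l)}"
proof (rule zariski_closedI)
  \<comment> \<open>\<open>?L\<close> and \<open>?R\<close> give coordinate \<open>r\<close> of the
    two bracketings of the product of basis vectors \<open>i\<close>, \<open>j\<close>,
    \<open>s\<close>.\<close>
  let ?L = "\<lambda>(i, j, s, r) l :: 'f ^ (2 \<times> 2 \<times> 2).
    l $ (i, j, 1) * l $ (1, s, r) + l $ (i, j, 2) * l $ (2, s, r)"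
  let ?R = "\<lambda>(i, j, s, r) l :: 'f ^ (2 \<times> 2 \<times> 2).
    l $ (j, s, 1) * l $ (i, 1, r) + l $ (j, s, 2) * l $ (i, 2, r)"
  let ?E = "range ?L \<union> range ?R"
  show "?E \<subseteq> range mveval"
    by (auto intro!: polynomial_add polynomial_quadratic)
  show "{l. null_triple_products (alg_of_vector l)} = {l. \<forall>f\<in>?E. f l = 0}"
  proof (intro set_eqI iffI)
    fix l :: "'f ^ (2 \<times> 2 \<times> 2)"
    define m where "m = alg_of_vector l"
    have m: "m \<in> algebras" by (simp add: m_def alg_of_vector_in_algebras)
    have st: "m (stdv i) (stdv j) = l $ (i, j, 1) *s stdv 1 + l $ (i, j, 2) *s stdv 2" for i j
      by (auto simp: m_def alg_of_vector_stdv vec_eq_iff forall_2)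
    have left: "m (m (stdv i) (stdv j)) (stdv s) $ r =
        l $ (i, j, 1) * l $ (1, s, r) + l $ (i, j, 2) * l $ (2, s, r)" for i j s r
      using m by (subst st) (simp add: algebras_iff m_def alg_of_vector_stdv)
    have right: "m (stdv i) (m (stdv j) (stdv s)) $ r =
        l $ (j, s, 1) * l $ (i, 1, r) + l $ (j, s, 2) * l $ (i, 2, r)" for i j s r
      using m by (subst st) (simp add: algebras_iff m_def alg_of_vector_stdv)
    {
      assume "l \<in> {l. null_triple_products (alg_of_vector l)}"
      then have "m (m x y) z = 0" "m x (m y z) = 0" for x y z
        by (auto simp: m_def null_triple_products_def)
      then show "l \<in> {l. \<forall>f\<in>?E. f l = 0}"
        by (auto simp: ball_Un simp flip: left right)
    next
      assume "l \<in> {l. \<forall>f\<in>?E. f l = 0}"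
      then have "m (m (stdv i) (stdv j)) (stdv s) $ r = 0"
        "m (stdv i) (m (stdv j) (stdv s)) $ r = 0" for i j s r
        unfolding left right by (auto simp: ball_Un)
      then have 0: "m (m (stdv i) (stdv j)) (stdv s) = 0"
        "m (stdv i) (m (stdv j) (stdv s)) = 0" for i j s
        by (auto simp: vec_eq_iff)
      have "m (m x y) z = 0 \<and> m x (m y z) = 0" for x y z
        using m 0
        by (subst (1 2) vec2_eq[of x], subst (1 2) vec2_eq[of y], subst (1 2) vec2_eq[of z])
          (simp add: algebras_iff)
      then show "l \<in> {l. null_triple_products (alg_of_vector l)}"
        by (auto simp: m_def null_triple_products_def)
    }
  qed
qed

lemma only_proper_degeneration_d2:
  fixes m :: "'f::field alg"
  assumes inf: "infinite (UNIV :: 'f set)" and m: "m \<in> algebras" and iso: "alg_iso m alg_d2"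
  shows "only_proper_degeneration_a2 m"
proof (rule only_proper_degeneration_a2I[OF inf m _ null_triple_products_closed])
  have "m \<notin> alternating_algebras"
    by (rule not_alternating_iso[OF iso alg_d2_square m])
  then show "m \<noteq> alg_a2"
    using alg_a2_in_algebras by (auto simp: alternating_algebras_def alg_a2_def)
  show "structure_vectors m \<subseteq> {l. null_triple_products (alg_of_vector l)}"
    using alg_iso_trans[OF _ iso, THEN null_triple_products_iso] null_triple_products_d2
    by (auto simp: structure_vectors_eq[OF m])
  show "alg_iso (alg_of_vector l) m"
    if "l \<in> {l. null_triple_products (alg_of_vector l)}" "alg_of_vector l \<noteq> alg_a2" for l
    using null_triple_products_imp_iso_d2[OF alg_of_vector_in_algebras, of l] that
    by (intro alg_iso_trans[OF _ alg_iso_sym[OF iso]]) simp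
qed

subsection \<open>The orbit closure of $e_2(\alpha)$\<close>

text \<open>These are the products \<open>(x, y) \<mapsto> \<alpha> f(x) y + (1 - \<alpha>) f(y) x\<close> with \<open>f\<close> a linear form, where
  \<open>f(b\<^sub>i) = l\<^sub>i\<^sub>i\<^sub>i\<close>; they form a linear space.\<close>

definition e2_closure :: "'f::field \<Rightarrow> ('f ^ (2 \<times> 2 \<times> 2)) set" where
  "e2_closure \<alpha> = {l. \<forall>i j k. l $ (i, j, k) =
     (if j = k then \<alpha> else 0) * l $ (i, i, i) + (if i = k then 1 - \<alpha> else 0) * l $ (j, j, j)}"

lemma e2_closure_closed: "zariski_closed (e2_closure \<alpha> :: ('f::field ^ (2 \<times> 2 \<times> 2)) set)"
proof (rule zariski_closedI)
  \<comment> \<open>Every term has the shape \<open>c * l $ i\<close> expected by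
    \<open>polynomial_linear\<close>, whence the factor \<open>- 1\<close>.\<close>
  let ?f = "\<lambda>(i, j, k) l :: 'f ^ (2 \<times> 2 \<times> 2). - 1 * l $ (i, j, k) +
    ((if j = k then \<alpha> else 0) * l $ (i, i, i) + (if i = k then 1 - \<alpha> else 0) * l $ (j, j, j))"
  show "range ?f \<subseteq> range mveval"
    by (rule image_subsetI, clarsimp simp only: prod.case)
      (intro polynomial_add polynomial_linear)
  show "e2_closure \<alpha> = {l. \<forall>f\<in>range ?f. f l = 0}"
    by (auto simp: e2_closure_def)
qed

text \<open>Pulling the first coordinate back along the isomorphism gives the linear form
  \<open>f\<close>. Its values on the basis are the diagonal entries, since \<alpha> and 1 -
  \<alpha> add up to 1.\<close>

lemma alg_iso_e2_imp_e2_closure: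
  assumes "alg_iso (alg_of_vector l) (alg_e2 \<alpha>)"
  shows "l \<in> e2_closure \<alpha>"
proof -
  define m where "m = alg_of_vector l"
  obtain \<phi> where lin: "Vector_Spaces.linear (*s) (*s) \<phi>" and bij: "bij \<phi>"
    and hom: "\<And>x y. \<phi> (m x y) = alg_e2 \<alpha> (\<phi> x) (\<phi> y)"
    using assms unfolding alg_iso_def m_def by blast
  define f where "f x = \<phi> x $ 1" for x
  have "\<phi> (m x y) = \<phi> ((\<alpha> * f x) *s y + ((1 - \<alpha>) * f y) *s x)" for x y
    using lin by (simp add: hom alg_e2_eq linear_vec_iff f_def)
  then have "m x y = (\<alpha> * f x) *s y + ((1 - \<alpha>) * f y) *s x" for x y
    using bij by (simp add: bij_def inj_eq)
  then have eq: "l $ (i, j, k) = \<alpha> * f (stdv i) * stdv j $ k + (1 - \<alpha>) * f (stdv j) * stdv i $ k" for i j k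
    using alg_of_vector_stdv[of l i j] by (simp add: m_def vec_eq_iff)
  have "l $ (i, i, i) = f (stdv i)" for i
    unfolding eq by (simp add: stdv_def algebra_simps)
  then show ?thesis
    by (auto simp: e2_closure_def eq stdv_def axis_def)
qed

text \<open>The diagonal entries determine a linear form \<open>f\<close>, nonzero because the
  product is nonzero. A vector with \<open>f u = 1\<close> and a vector spanning the kernel of
  \<open>f\<close> then have the table of \<open>alg_e2 \<alpha>\<close>.\<close>

lemma e2_closure_imp_alg_iso_e2:
  fixes l :: "'f::field ^ (2 \<times> 2 \<times> 2)"
  assumes l: "l \<in> e2_closure \<alpha>" and "alg_of_vector l \<noteq> alg_a2"
  shows "alg_iso (alg_of_vector l) (alg_e2 \<alpha>)"
proof -
  define f where "f x = x $ 1 * l $ (1, 1, 1) + x $ 2 * l $ (2, 2, 2)" for x :: "'f ^ 2"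
  have "alg_of_vector l (stdv i) (stdv j) =
      (\<alpha> * f (stdv i)) *s stdv j + ((1 - \<alpha>) * f (stdv j)) *s stdv i" for i j
  proof -
    have "f (stdv i) = l $ (i, i, i)" for i
      using exhaust_2[of i] by (auto simp: f_def)
    then have "alg_of_vector l (stdv i) (stdv j) $ k =
      ((\<alpha> * f (stdv i)) *s stdv j + ((1 - \<alpha>) * f (stdv j)) *s stdv i) $ k" for k
      using l[unfolded e2_closure_def mem_Collect_eq, rule_format, of i j k]
      by (simp add: alg_of_vector_stdv) (auto simp: stdv_def axis_def)
    then show ?thesis by (simp add: vec_eq_iff)
  qed
  moreover have "(\<lambda>x y. (\<alpha> * f x) *s y + ((1 - \<alpha>) * f y) *s x) \<in> algebras"
    by (auto simp: algebras_iff f_def vec_eq_iff algebra_simps)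
  ultimately have mult: "alg_of_vector l = (\<lambda>x y. (\<alpha> * f x) *s y + ((1 - \<alpha>) * f y) *s x)"
    by (intro algebra_eqI alg_of_vector_in_algebras)
  have "\<exists>i. l $ (i, i, i) \<noteq> 0"
  proof (rule ccontr)
    assume "\<nexists>i. l $ (i, i, i) \<noteq> 0"
    then have "f x = 0" for x by (simp add: f_def)
    then show False using assms(2) by (simp add: mult alg_a2_def fun_eq_iff)
  qed
  then obtain i where i: "l $ (i, i, i) \<noteq> 0" by blast
  define u where "u = (1 / l $ (i, i, i)) *s stdv i"
  define v :: "'f ^ 2" where "v = (- l $ (2, 2, 2)) *s stdv 1 + l $ (1, 1, 1) *s stdv 2"
  have fu: "f u = 1" using i exhaust_2[of i] by (auto simp: f_def u_def)
  have fv: "f v = 0" by (simp add: f_def v_def)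
  have "v \<noteq> 0" using i exhaust_2[of i] by (auto simp: v_def vec_eq_iff forall_2)
  have "v \<noteq> c *s u" for c
  proof
    assume c: "v = c *s u"
    have "f (c *s u) = c * f u" by (simp add: f_def algebra_simps)
    then have "c = 0" using c fu fv by simp
    then show False using c \<open>v \<noteq> 0\<close> by simp
  qed
  moreover have "u \<noteq> 0" using fu by (auto simp: f_def)
  ultimately have b: "ordered_basis (\<lambda>i. if i = 1 then u else v)" by (intro ordered_basis_pair)
  have "alg_iso (alg_e2 \<alpha>) (alg_of_vector l)"
  proof (rule alg_iso_basisI[OF alg_of_vector_in_algebras alg_e2_in_algebras b])
    fix i j :: 2
    show "alg_of_vector l (if i = 1 then u else v) (if j = 1 then u else v) =
      lincomb (\<lambda>i. if i = 1 then u else v) (alg_e2 \<alpha> (stdv i) (stdv j))"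
      using exhaust_2[of i] exhaust_2[of j]
      by (auto simp: mult fu fv lincomb_2 alg_e2_eq vec_eq_iff algebra_simps)
  qed
  then show ?thesis by (rule alg_iso_sym)
qed

lemma only_proper_degeneration_e2:
  fixes m :: "'f::field alg"
  assumes inf: "infinite (UNIV :: 'f set)" and m: "m \<in> algebras" and iso: "alg_iso m (alg_e2 \<alpha>)"
  shows "only_proper_degeneration_a2 m"
proof (rule only_proper_degeneration_a2I[OF inf m _ e2_closure_closed])
  have "m \<notin> alternating_algebras"
    by (rule not_alternating_iso[OF iso alg_e2_square m])
  then show "m \<noteq> alg_a2"
    using alg_a2_in_algebras by (auto simp: alternating_algebras_def alg_a2_def)
  show "structure_vectors m \<subseteq> e2_closure \<alpha>"
    using alg_iso_trans[OF _ iso, THEN alg_iso_e2_imp_e2_closure]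
    by (auto simp: structure_vectors_eq[OF m])
  show "alg_iso (alg_of_vector l) m"
    if "l \<in> e2_closure \<alpha>" "alg_of_vector l \<noteq> alg_a2" for l
    by (rule alg_iso_trans[OF e2_closure_imp_alg_iso_e2[OF that] alg_iso_sym[OF iso]])
qed

section \<open>Degenerations of non-alternating algebras\<close>

lemma limit_in_structure_vectors:
  assumes "alg_of_vector l = n"
  shows "l \<in> structure_vectors n"
  using assms by (metis alg_iso_refl alg_of_vector_in_algebras mem_Collect_eq structure_vectors_eq)

lemma degenerates_to_d2:
  fixes m :: "'f::field alg"
  assumes inf: "infinite (UNIV :: 'f set)" and m: "m \<in> algebras"
    and x: "x \<noteq> 0" "\<And>c. m x x \<noteq> c *s x"
  shows "\<exists>l \<in> structure_vectors alg_d2. l \<in> zariski_closure (structure_vectors m)"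
proof -
  define b where "b = (\<lambda>i::2. if i = 1 then x else m x x)"
  \<comment> \<open>Every weight is at most 2 and every sum of two weights at least 2, with equality
    only at \<open>(1, 1, 2)\<close>. That entry is 1 because \<open>b 2\<close> is the square of
    \<open>b 1\<close>.\<close>
  define a where "a = (\<lambda>i::2. if i = 1 then 1 else 2 :: nat)"
  define l where "l = vec_lambda (\<lambda>(i, j, k). if a i + a j = a k then structure_vector m b $ (i, j, k) else 0)"
  have b: "ordered_basis b" unfolding b_def by (rule ordered_basis_pair[OF x])
  have "l \<in> zariski_closure (structure_vectors m)"
    unfolding l_def by (rule weighted_limit[OF inf m b]) (simp add: a_def)
  moreover have "m (b 1) (b 1) = lincomb b (stdv 2)" by (simp add: b_def)
  then have "structure_vector m b $ (1, 1, 2) = stdv 2 $ 2"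
    by (rule structure_vector_unique[OF b])
  then have "alg_of_vector l (stdv i) (stdv j) = alg_d2 (stdv i) (stdv j)" for i j
    using exhaust_2[of i] exhaust_2[of j]
    by (auto simp: alg_of_vector_stdv alg_d2_eq l_def a_def vec_eq_iff forall_2)
  then have "alg_of_vector l = alg_d2"
    by (intro algebra_eqI alg_of_vector_in_algebras alg_d2_in_algebras)
  ultimately show ?thesis using limit_in_structure_vectors by blast
qed

lemma degenerates_to_e2:
  fixes m :: "'f::field alg"
  assumes inf: "infinite (UNIV :: 'f set)" and m: "m \<in> algebras" and b: "ordered_basis b"
    and mult: "m (b 1) (b 1) = b 1" "m (b 2) (b 2) = 0" "m (b 1) (b 2) + m (b 2) (b 1) = b 2"
  shows "\<exists>\<alpha>. \<exists>l \<in> structure_vectors (alg_e2 \<alpha>). l \<in> zariski_closure (structure_vectors m)"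
proof -
  define s where "s = structure_vector m b"
  \<comment> \<open>The only entry with a negative exponent is \<open>(1, 1, 2)\<close>, which is
    zero as \<open>b 1\<close> is idempotent. The entries \<open>(1, 1, 1)\<close>,
    \<open>(1, 2, 2)\<close> and \<open>(2, 1, 2)\<close> survive, and the last two add up to
    1.\<close>
  define a where "a = (\<lambda>i::2. if i = 1 then 0 else 1 :: nat)"
  define l where "l = vec_lambda (\<lambda>(i, j, k). if a i + a j = a k then s $ (i, j, k) else 0)"
  have "m (b 1) (b 1) = lincomb b (stdv 1)" by (simp add: mult)
  then have "s $ (1, 1, k) = stdv 1 $ k" for k
    unfolding s_def by (rule structure_vector_unique[OF b])
  then have s11: "s $ (1, 1, 1) = 1" "s $ (1, 1, 2) = 0" by simp_all
  have "lincomb b (\<chi> k. s $ (1, 2, k) + s $ (2, 1, k)) = m (b 1) (b 2) + m (b 2) (b 1)"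
    using structure_vector_lincomb[OF b, of m 1 2] structure_vector_lincomb[OF b, of m 2 1]
    by (simp add: s_def lincomb_2 algebra_simps vec.scale_left_distrib)
  also have "\<dots> = lincomb b (stdv 2)" by (simp add: mult)
  finally have "(\<chi> k. s $ (1, 2, k) + s $ (2, 1, k)) = stdv 2"
    by (rule injD[OF bij_is_inj[OF b[unfolded ordered_basis_iff_bij]]])
  then have s12: "s $ (2, 1, 2) = 1 - s $ (1, 2, 2)"
    by (simp add: vec_eq_iff forall_2 algebra_simps)
  have w: "s $ (i, j, k) = 0 \<or> a k \<le> a i + a j" for i j k
    using exhaust_2[of i] exhaust_2[of j] exhaust_2[of k] s11 by (auto simp: a_def)
  have "l \<in> zariski_closure (structure_vectors m)"
    unfolding l_def s_def using weighted_limit[OF inf m b w[unfolded s_def]] .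
  moreover have "alg_of_vector l (stdv i) (stdv j) = alg_e2 (s $ (1, 2, 2)) (stdv i) (stdv j)" for i j
    using exhaust_2[of i] exhaust_2[of j] s11 s12
    by (auto simp: alg_of_vector_stdv alg_e2_eq l_def a_def vec_eq_iff forall_2)
  then have "alg_of_vector l = alg_e2 (s $ (1, 2, 2))"
    by (intro algebra_eqI alg_of_vector_in_algebras alg_e2_in_algebras)
  ultimately show ?thesis using limit_in_structure_vectors by blast
qed

text \<open>Scaling \<open>x0\<close> gives an idempotent \<open>u\<close>. For \<open>y\<close>
  independent of \<open>u\<close>, proportionality of the squares of all \<open>u + t *s y\<close>
  determines \<open>m u y + m y u\<close>, and subtracting a multiple of \<open>u\<close> from
  \<open>y\<close> makes its square vanish.\<close>

lemma all_squares_proportional_imp_basis: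
  fixes m :: "'f::field alg"
  assumes inf: "infinite (UNIV :: 'f set)" and m: "m \<in> algebras"
    and sq: "\<And>x. \<exists>c. m x x = c *s x" and nz: "m x0 x0 \<noteq> 0"
  shows "\<exists>b. ordered_basis b \<and> m (b 1) (b 1) = b 1 \<and> m (b 2) (b 2) = 0 \<and>
    m (b 1) (b 2) + m (b 2) (b 1) = b 2"
proof -
  have m': "m (x + y) z = m x z + m y z" "m x (y + z) = m x y + m x z"
    "m (c *s x) y = c *s m x y" "m x (c *s y) = c *s m x y" for x y z c
    using m unfolding algebras_iff by blast+
  obtain c where c: "m x0 x0 = c *s x0" using sq by blast
  have "c \<noteq> 0" using c nz by auto
  define u where "u = (1 / c) *s x0"
  have uu: "m u u = u" using \<open>c \<noteq> 0\<close> by (simp add: u_def m' c vector_smult_assoc)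
  have "u \<noteq> 0" using nz m \<open>c \<noteq> 0\<close> by (auto simp: u_def algebras_zero)
  obtain y where y: "\<And>c. y \<noteq> c *s u" using ex_not_collinear[of u] by blast
  define b where "b = (\<lambda>i::2. if i = 1 then u else y)"
  have b: "bij (lincomb b)"
    using ordered_basis_pair[OF \<open>u \<noteq> 0\<close> y] by (simp add: b_def ordered_basis_iff_bij)
  obtain d where d: "m y y = d *s y" using sq by blast
  obtain w where w: "m u y + m y u = lincomb b w" using b by (metis bij_pointE)
  \<comment> \<open>compare coefficients in the square of \<open>u + t y\<close>\<close>
  have key: "w $ 2 + t * d = 1 + t * w $ 1" if t: "t \<noteq> 0" for t
  proof -
    obtain s where s: "m (u + t *s y) (u + t *s y) = s *s (u + t *s y)" using sq by blast
    have "m (u + t *s y) (u + t *s y) = u + t *s (m u y + m y u) + (t * t * d) *s y"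
      by (simp add: m' uu d vector_smult_assoc vector_add_ldistrib algebra_simps)
    also have "\<dots> = lincomb b (\<chi> i. if i = 1 then 1 + t * w $ 1 else t * w $ 2 + t * t * d)"
      unfolding w by (simp add: lincomb_2 b_def vec_eq_iff algebra_simps)
    finally have "lincomb b (\<chi> i. if i = 1 then 1 + t * w $ 1 else t * w $ 2 + t * t * d) =
        lincomb b (\<chi> i. if i = 1 then s else s * t)"
      unfolding s by (simp add: lincomb_2 b_def vec_eq_iff algebra_simps)
    then have "(\<chi> i::2. if i = 1 then 1 + t * w $ 1 else t * w $ 2 + t * t * d) =
        (\<chi> i. if i = 1 then s else s * t)"
      using b by (simp add: bij_def inj_eq)
    then have "1 + t * w $ 1 = s" "t * w $ 2 + t * t * d = s * t"
      by (auto simp: vec_eq_iff forall_2)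
    then have "t * (w $ 2 + t * d) = t * (1 + t * w $ 1)" by (simp add: algebra_simps)
    then show ?thesis using t by simp
  qed
  \<comment> \<open>The relation \<open>key\<close> at 1 and at one further nonzero parameter
    separates its constant and linear parts.\<close>
  have "\<not> UNIV \<subseteq> {0, 1 :: 'f}" using inf finite_subset by blast
  then obtain t :: 'f where t: "t \<noteq> 0" "t \<noteq> 1" by blast
  have "(t - 1) * (d - w $ 1) = 0"
    using key[of 1] key[OF t(1)] by simp algebra
  then have dw: "d = w $ 1" using t by simp
  then have w2: "w $ 2 = 1" using key[of 1] by simp
  \<comment> \<open>Since \<open>m u y + m y u\<close> is \<open>d *s u + y\<close>, the square of
    \<open>v\<close> is \<open>d *s y - d *s (d *s u + y) + (d * d) *s u\<close>, which is
    zero.\<close>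
  define v where "v = y - d *s u"
  have sum: "m u y + m y u = d *s u + y" by (simp add: w lincomb_2 b_def dw w2)
  have v: "v = y + (- d) *s u" by (simp add: v_def vec_eq_iff)
  have "m v v = (m y y + (- d) *s m u y) + (- d) *s (m y u + (- d) *s m u u)"
    unfolding v by (simp only: m' vec.scale_right_distrib add_ac)
  then have "m v v = m y y - d *s (m u y + m y u) + (d * d) *s m u u"
    by (simp add: vec_eq_iff algebra_simps)
  then have vv: "m v v = 0" by (simp add: sum d uu vec_eq_iff algebra_simps)
  have "m u v + m v u = (m u y + (- d) *s m u u) + (m y u + (- d) *s m u u)"
    unfolding v by (simp only: m')
  then have "m u v + m v u = (m u y + m y u) - (d + d) *s m u u"
    by (simp add: vec_eq_iff algebra_simps)
  then have uv: "m u v + m v u = v" by (simp add: sum uu v_def vec_eq_iff algebra_simps)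
  have "v \<noteq> c *s u" for c
  proof
    assume "v = c *s u"
    then have "y = (c + d) *s u" by (simp add: v_def vec_eq_iff algebra_simps)
    with y show False by blast
  qed
  then have "ordered_basis (\<lambda>i. if i = 1 then u else v)"
    using \<open>u \<noteq> 0\<close> by (intro ordered_basis_pair)
  then show ?thesis
    using uu vv uv by (intro exI[of _ "\<lambda>i::2. if i = 1 then u else v"]) simp
qed

text \<open>Otherwise \<open>n\<close> would be a proper degeneration of \<open>m\<close> different
  from \<open>alg_a2\<close>.\<close>

lemma only_proper_degeneration_a2D:
  fixes m :: "'f::field alg"
  assumes "only_proper_degeneration_a2 m" and m: "m \<in> algebras" and n: "n \<in> algebras" "n \<noteq> alg_a2"
    and "\<exists>l \<in> structure_vectors n. l \<in> zariski_closure (structure_vectors m)"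
  shows "alg_iso m n"
  using assms properly_degenerates_iff[OF m n(1)] alg_iso_a2_iff[of n]
  unfolding only_proper_degeneration_a2_def by blast

lemma only_proper_degeneration_a2_imp_iso:
  fixes m :: "'f::field alg"
  assumes inf: "infinite (UNIV :: 'f set)" and m: "m \<in> algebras"
    and "m \<notin> alternating_algebras" and opd: "only_proper_degeneration_a2 m"
  shows "alg_iso m alg_d2 \<or> (\<exists>\<alpha>. alg_iso m (alg_e2 \<alpha>))"
proof (cases "\<exists>x. x \<noteq> 0 \<and> (\<forall>c. m x x \<noteq> c *s x)")
  case True
  have "(alg_d2 :: 'f alg) \<noteq> alg_a2" using alg_d2_square by (metis alg_a2_def)
  then show ?thesis
    using True degenerates_to_d2[OF inf m] only_proper_degeneration_a2D[OF opd m alg_d2_in_algebras] by blast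
next
  case False
  then have "\<exists>c. m x x = c *s x" for x
    using algebras_zero[OF m, of x] by (cases "x = 0") auto
  moreover obtain x0 where "m x0 x0 \<noteq> 0"
    using assms by (auto simp: alternating_algebras_def)
  ultimately obtain \<alpha> where \<alpha>: "\<exists>l \<in> structure_vectors (alg_e2 \<alpha>). l \<in> zariski_closure (structure_vectors m)"
    using all_squares_proportional_imp_basis[OF inf m] degenerates_to_e2[OF inf m] by metis
  have "alg_e2 \<alpha> \<noteq> alg_a2" using alg_e2_square by (metis alg_a2_def)
  then have "alg_iso m (alg_e2 \<alpha>)"
    by (rule only_proper_degeneration_a2D[OF opd m alg_e2_in_algebras _ \<alpha>])
  then show ?thesis by blast
qed

section \<open>Pairwise non-isomorphism of the listed algebras\<close>

lemma not_alg_iso_d2_e2: "\<not> alg_iso alg_d2 (alg_e2 \<alpha>)"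
proof
  assume "alg_iso alg_d2 (alg_e2 \<alpha>)"
  then obtain \<phi> where lin: "Vector_Spaces.linear (*s) (*s) \<phi>" and bij: "bij \<phi>"
    and hom: "\<And>x y. \<phi> (alg_d2 x y) = alg_e2 \<alpha> (\<phi> x) (\<phi> y)"
    unfolding alg_iso_def by blast
  interpret Vector_Spaces.linear "(*s)" "(*s)" \<phi> by fact
  \<comment> \<open>The vector \<open>stdv 1\<close> is a nonzero idempotent of
    \<open>alg_e2 \<alpha>\<close>, while the only idempotent of \<open>alg_d2\<close> is
    zero.\<close>
  obtain x where x: "stdv 1 = \<phi> x" using bij by (metis bij_pointE)
  have "\<phi> (alg_d2 x x) = \<phi> x"
    unfolding hom x[symmetric] by (simp add: alg_e2_eq vec_eq_iff algebra_simps)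
  then have "alg_d2 x x = x" using bij by (simp add: bij_def inj_eq)
  then have "x = 0" by (auto simp: alg_d2_eq vec_eq_iff forall_2)
  then have "stdv 1 = (0 :: 'a ^ 2)" using x by (simp add: zero)
  then show False by (simp add: vec_eq_iff forall_2)
qed

lemma alg_iso_e2_imp_eq:
  assumes "alg_iso (alg_e2 \<alpha>) (alg_e2 \<beta>)"
  shows "\<alpha> = \<beta>"
proof -
  obtain \<phi> where lin: "Vector_Spaces.linear (*s) (*s) \<phi>" and bij: "bij \<phi>"
    and hom: "\<And>x y. \<phi> (alg_e2 \<alpha> x y) = alg_e2 \<beta> (\<phi> x) (\<phi> y)"
    using assms unfolding alg_iso_def by blast
  interpret Vector_Spaces.linear "(*s)" "(*s)" \<phi> by fact
  have ne: "\<phi> x \<noteq> 0" if "x \<noteq> 0" for x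
    using bij that by (auto simp: bij_def inj_iff_eq_0)
  have st: "stdv 1 \<noteq> (0 :: 'a ^ 2)" "stdv 2 \<noteq> (0 :: 'a ^ 2)"
    by (auto simp: vec_eq_iff forall_2)
  have sq: "alg_e2 \<gamma> x x = x $ 1 *s x" for \<gamma> and x :: "'a ^ 2"
    by (simp add: alg_e2_eq vec_eq_iff algebra_simps)
  \<comment> \<open>Squaring multiplies \<open>x\<close> by \<open>x $ 1\<close> whatever the
    parameter, so an isomorphism preserves first coordinates. The product of \<open>stdv 1\<close>
    and \<open>stdv 2\<close> then reveals the parameter.\<close>
  have first: "\<phi> x $ 1 = x $ 1" if "x \<noteq> 0" for x
    using hom[of x x] ne[OF that] by (simp add: sq scale)
  have "\<alpha> *s \<phi> (stdv 2) = \<beta> *s \<phi> (stdv 2)"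
    using hom[of "stdv 1" "stdv 2"] by (simp add: alg_e2_eq first st scale)
  then show ?thesis using ne[OF st(2)] by simp
qed

theorem mainTheorem3:
  assumes "infinite (UNIV :: 'f::field set)"
  shows "{m \<in> algebras - alternating_algebras. only_proper_degeneration_a2 m} =
           {m \<in> algebras. alg_iso m (alg_d2 :: 'f alg) \<or> (\<exists>\<alpha>. alg_iso m (alg_e2 \<alpha>))}
       \<and> (\<forall>\<alpha>. \<not> alg_iso (alg_d2 :: 'f alg) (alg_e2 \<alpha>))
       \<and> (\<forall>\<alpha> \<beta> :: 'f. alg_iso (alg_e2 \<alpha>) (alg_e2 \<beta>) \<longrightarrow> \<alpha> = \<beta>)"
proof (intro conjI allI impI)
  have "m \<notin> alternating_algebras"
    if "m \<in> algebras" "alg_iso m alg_d2 \<or> (\<exists>\<alpha>. alg_iso m (alg_e2 \<alpha>))" for m :: "'f alg"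
    using that not_alternating_iso[of m alg_d2, OF _ alg_d2_square]
      not_alternating_iso[of m "alg_e2 _", OF _ alg_e2_square] by blast
  then show "{m \<in> algebras - alternating_algebras. only_proper_degeneration_a2 m} =
      {m \<in> algebras. alg_iso m (alg_d2 :: 'f alg) \<or> (\<exists>\<alpha>. alg_iso m (alg_e2 \<alpha>))}"
    using only_proper_degeneration_a2_imp_iso[OF assms] only_proper_degeneration_d2[OF assms]
      only_proper_degeneration_e2[OF assms] by blast
qed (use not_alg_iso_d2_e2 alg_iso_e2_imp_eq in blast)+

end
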